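(* Let $n\ge 1$, let $K,L \in \mathcal{K}^n_0$ and $p \in [-\infty,\infty]$. Then \[ \underline{M}_p(K,L) \subset \overline{M}_p(K,L), \] with equality if and only if $n=1$, or $p \in\{-\infty,\infty\}$, or $K$ and $L$ are dilates of each other.
   Context: $\mathcal{K}^n_0$ denotes the set of compact convex subsets of $\mathbb{R}^n$ containing the origin in their interior. For $C\in\mathcal{K}^n_0$, $h_C(a)=\sup\{a^Tx : x\in C\}$ is the support function and $\|x\|_C=\inf\{\lambda\ge 0 : x\in\lambda C\}$ the gauge function. For $x,y>0$, $m_p(x,y)=\left(\frac{x^p+y^p}{2}\right)^{1/p}$ if $p\in\mathbb{R}\setminus\{0\}$, $m_0(x,y)=\sqrt{xy}$, $m_{-\infty}(x,y)=\min\{x,y\}$, $m_\infty(x,y)=\max\{x,y\}$. $\mathbb{S}_2$ is the Euclidean unit sphere in $\mathbb{R}^n$. For $K,L\in\mathcal{K}^n_0$ and $p\in[-\infty,\infty]$, the upper $p$-mean is \[ \overline{M}_p(K,L)=\{x\in\mathbb{R}^n : a^Tx\le m_p(h_K(a),h_L(a)) \text{ for all } a\in\mathbb{S}_2\}, \] and the lower $p$-mean is \[ \underline{M}_p(K,L)=\mathrm{conv}\left(\left\{m_p(\|v\|_K^{-1},\|v\|_L^{-1})\,v : v\in\mathbb{S}_2\right\}\right). \] $K$ and $L$ are dilates of each other if $L=\lambda K$ for some $\lambda>0$. The symbol $\subset$ allows equality. *)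

theory Defs
  imports "HOL-Analysis.Analysis"
begin

definition convex_body0 :: "'a::euclidean_space set \<Rightarrow> bool" where
  "convex_body0 C \<longleftrightarrow> compact C \<and> convex C \<and> 0 \<in> interior C"

text \<open>The supremum and the infimum below are taken in \<open>real\<close>, so the next two functions
  are meaningful only where these are finite, in particular for
  \<^const>\<open>convex_body0\<close> sets.\<close>

definition support_function :: "'a::euclidean_space set \<Rightarrow> 'a \<Rightarrow> real" where
  "support_function C a = (SUP x\<in>C. a \<bullet> x)"

definition gauge_function :: "'a::euclidean_space set \<Rightarrow> 'a \<Rightarrow> real" where
  "gauge_function C x = Inf {t::real. 0 \<le> t \<and> x \<in> (\<lambda>y. t *\<^sub>R y) ` C}"

text \<open>Intended for \<open>x, y > 0\<close> only.\<close>

definition p_mean :: "ereal \<Rightarrow> real \<Rightarrow> real \<Rightarrow> real" where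
  "p_mean p x y =
    (case p of
       ereal r \<Rightarrow> if r = 0 then sqrt (x * y)
                  else ((x powr r + y powr r) / 2) powr (1 / r)
     | PInfty \<Rightarrow> max x y
     | MInfty \<Rightarrow> min x y)"

definition upper_mean ::
    "ereal \<Rightarrow> 'a::euclidean_space set \<Rightarrow> 'a set \<Rightarrow> 'a set" where
  "upper_mean p K L =
    {x. \<forall>a\<in>sphere 0 1. a \<bullet> x \<le> p_mean p (support_function K a) (support_function L a)}"

definition lower_mean ::
    "ereal \<Rightarrow> 'a::euclidean_space set \<Rightarrow> 'a set \<Rightarrow> 'a set" where
  "lower_mean p K L =
    convex hull ((\<lambda>v. p_mean p (inverse (gauge_function K v)) (inverse (gauge_function L v)) *\<^sub>R v)
                 ` sphere 0 1)"

definition dilates :: "'a::euclidean_space set \<Rightarrow> 'a set \<Rightarrow> bool" where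
  "dilates K L \<longleftrightarrow> (\<exists>t::real. t > 0 \<and> L = (\<lambda>y. t *\<^sub>R y) ` K)"

end

theory Submission
  imports Defs
begin

text \<open>
  Write \<open>h\<close> for support functions and \<open>r\<close> for radial functions (inverses of gauges).
  A power mean \<open>m\<close> is monotone and homogeneous, and \<open>r\<^sub>C(v) (a \<bullet> v) \<le> h\<^sub>C(a)\<close> because
  \<open>r\<^sub>C(v) v\<close> lies in \<open>C\<close>. Applying \<open>m\<close> to this inequality for \<open>K\<close> and \<open>L\<close> gives the inclusion.

  The three sufficient conditions for equality reduce to the remark that the lower mean is star-shaped
  about the origin: a point \<open>s v\<close> of the upper mean, with \<open>v\<close> a unit vector, only has to satisfy
  \<open>s \<le> m(r\<^sub>K(v), r\<^sub>L(v))\<close>. For \<open>p = \<infinity>\<close> one uses instead that both means are the convex hull of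
  \<open>K \<union> L\<close>.

  For the converse let \<open>p\<close> be finite, let both means equal \<open>M\<close>, and let \<open>a\<close> be a unit vector.
  An extreme point \<open>x\<close> of the face of \<open>M\<close> in direction \<open>a\<close> is one of the generators
  \<open>m(r\<^sub>K(v), r\<^sub>L(v)) v\<close> of the lower mean. If the inequality \<open>b \<bullet> x \<le> m(h\<^sub>K(b), h\<^sub>L(b))\<close>
  defining the upper mean is tight at \<open>x\<close>, strict monotonicity of \<open>m\<close> shows that \<open>r\<^sub>K(v) v\<close> and
  \<open>r\<^sub>L(v) v\<close> are points where \<open>b\<close> is maximal on \<open>K\<close> and on \<open>L\<close>. The inequality for \<open>a\<close> itself
  need not be tight, but \<open>a\<close> is a nonnegative combination of vectors \<open>b\<close> for which it is
  (\<open>mem_convex_hull_polar_generators\<close>, a statement on the polar of \<open>M\<close>). Hence in every direction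
  \<open>K\<close> and \<open>L\<close> have contact points on a common ray (\<open>parallel_contact_points\<close>).

  If \<open>h\<^sub>K\<close> and \<open>h\<^sub>L\<close> were differentiable, this would say that \<open>ln h\<^sub>K\<close> and \<open>ln h\<^sub>L\<close> have the same
  gradient. In general \<open>ratio_const_if_common_log_subgradient\<close> replaces the gradients by subgradients
  and shows by a telescoping estimate that \<open>h\<^sub>K / h\<^sub>L\<close> is constant along every segment avoiding the
  origin. In dimension at least two any two nonzero vectors are joined by at most two such segments,
  so the ratio is constant and \<open>K\<close> and \<open>L\<close> are dilates.
\<close>

section \<open>Power means of two positive numbers\<close>

lemma p_mean_simps:
  "p_mean (ereal r) x y =
     (if r = 0 then sqrt (x * y) else ((x powr r + y powr r) / 2) powr (1 / r))"
  "p_mean \<infinity> x y = max x y"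
  "p_mean (-\<infinity>) x y = min x y"
  by (simp_all add: p_mean_def)

lemma p_mean_pos: "0 < x \<Longrightarrow> 0 < y \<Longrightarrow> 0 < p_mean p x y"
  by (cases p) (auto simp: p_mean_simps add_nonneg_eq_0_iff)

lemma p_mean_mult:
  assumes "0 < c" "0 < x" "0 < y"
  shows "p_mean p (c * x) (c * y) = c * p_mean p x y"
proof (cases p)
  case (real r)
  show ?thesis
  proof (cases "r = 0")
    case True
    have "sqrt (c * x * (c * y)) = sqrt (c\<^sup>2 * (x * y))"
      by (simp add: power2_eq_square algebra_simps)
    then show ?thesis
      using assms real True by (simp add: p_mean_simps real_sqrt_mult)
  next
    case False
    have "((c * x) powr r + (c * y) powr r) / 2 = c powr r * ((x powr r + y powr r) / 2)"
      using assms by (simp add: powr_mult algebra_simps)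
    then have "(((c * x) powr r + (c * y) powr r) / 2) powr (1 / r)
        = (c powr r) powr (1 / r) * ((x powr r + y powr r) / 2) powr (1 / r)"
      by (simp only: powr_mult)
    then show ?thesis
      using assms real False by (simp add: p_mean_simps powr_powr)
  qed
qed (use assms in \<open>auto simp: p_mean_simps max_mult_distrib_left min_mult_distrib_left\<close>)

text \<open>Strictness fails for the maximum and the minimum, and with it the conclusion that equality of
  the two means forces dilates.\<close>

lemma p_mean_strict_mono:
  assumes "0 < x" "0 < y" "x \<le> x'" "y \<le> y'" "x < x' \<or> y < y'"
  shows "p_mean (ereal r) x y < p_mean (ereal r) x' y'"
proof -
  consider "r = 0" | "r > 0" | "r < 0" by linarith
  then show ?thesis
  proof cases
    case 1
    have "x * y < x' * y'"
      using assms mult_less_le_imp_less[of x x' y y'] mult_le_less_imp_less[of x x' y y'] by auto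
    then show ?thesis using 1 by (simp add: p_mean_simps)
  next
    case 2
    have "x powr r \<le> x' powr r" "y powr r \<le> y' powr r"
      using assms 2 by (auto intro: powr_mono2)
    moreover have "x powr r < x' powr r \<or> y powr r < y' powr r"
      using assms 2 by (auto intro: powr_less_mono2)
    ultimately have "(x powr r + y powr r) / 2 < (x' powr r + y' powr r) / 2" by auto
    then show ?thesis
      using assms 2 by (auto simp: p_mean_simps intro!: powr_less_mono2)
  next
    case 3
    have "x' powr r \<le> x powr r" "y' powr r \<le> y powr r"
      using assms 3 by (auto intro: powr_mono2')
    moreover have "x' powr r < x powr r \<or> y' powr r < y powr r"
      using assms 3 by (auto intro: powr_less_mono2_neg)
    ultimately have "(x' powr r + y' powr r) / 2 < (x powr r + y powr r) / 2" by auto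
    moreover have "0 < (x' powr r + y' powr r) / 2"
      using assms by (simp add: add_pos_pos)
    ultimately show ?thesis
      using assms 3 by (auto simp: p_mean_simps intro!: powr_less_mono2_neg)
  qed
qed

lemma p_mean_mono:
  assumes "0 < x" "0 < y" "x \<le> x'" "y \<le> y'"
  shows "p_mean p x y \<le> p_mean p x' y'"
proof (cases p)
  case (real r)
  show ?thesis
  proof (cases "x < x' \<or> y < y'")
    case True
    then show ?thesis using p_mean_strict_mono[OF assms True, of r] real by simp
  next
    case False
    then have "x = x'" "y = y'" using assms by auto
    then show ?thesis by simp
  qed
qed (use assms in \<open>auto simp: p_mean_simps\<close>)

lemma continuous_on_p_mean:
  assumes "continuous_on S f" "continuous_on S g" "\<And>a. a \<in> S \<Longrightarrow> 0 < f a" "\<And>a. a \<in> S \<Longrightarrow> 0 < g a"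
  shows "continuous_on S (\<lambda>a. p_mean (ereal r) (f a) (g a))"
proof (cases "r = 0")
  case True
  then show ?thesis using assms by (auto simp: p_mean_simps intro!: continuous_intros)
next
  case False
  have "(f a powr r + g a powr r) / 2 \<noteq> 0" if "a \<in> S" for a
    using assms(3,4)[OF that] by (smt (verit) divide_pos_pos powr_gt_zero)
  then show ?thesis
    using assms False by (fastforce simp: p_mean_simps intro!: continuous_intros)
qed

section \<open>Support functions and radial functions of convex bodies\<close>

lemma support_function_attained:
  assumes "convex_body0 C"
  obtains x where "x \<in> C" "support_function C a = a \<bullet> x" "\<And>y. y \<in> C \<Longrightarrow> a \<bullet> y \<le> a \<bullet> x"
proof -
  have C: "compact C" "C \<noteq> {}"
    using assms interior_subset by (auto simp: convex_body0_def)
  obtain x where x: "x \<in> C" "\<forall>y\<in>C. a \<bullet> y \<le> a \<bullet> x"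
    using continuous_attains_sup[OF C continuous_on_inner[OF continuous_on_const continuous_on_id]]
    by auto
  then have "support_function C a = a \<bullet> x"
    unfolding support_function_def by (intro cSup_eq_maximum) auto
  with x that show thesis by blast
qed

lemma inner_le_support_function:
  "convex_body0 C \<Longrightarrow> x \<in> C \<Longrightarrow> a \<bullet> x \<le> support_function C a"
  by (metis support_function_attained)

lemma support_function_pos:
  fixes a :: "'a::euclidean_space"
  assumes "convex_body0 C" "a \<noteq> 0"
  shows "0 < support_function C a"
proof -
  obtain e where e: "e > 0" "cball 0 e \<subseteq> C"
    using assms mem_interior_cball[of 0 C] by (auto simp: convex_body0_def)
  have "(e / norm a) *\<^sub>R a \<in> C" using e assms by (auto simp: subset_iff)
  then have "a \<bullet> ((e / norm a) *\<^sub>R a) \<le> support_function C a"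
    by (rule inner_le_support_function[OF assms(1)])
  moreover have "0 < a \<bullet> ((e / norm a) *\<^sub>R a)" using e assms by simp
  ultimately show ?thesis by linarith
qed

lemma support_function_scaleR:
  assumes "convex_body0 C" "0 \<le> c"
  shows "support_function C (c *\<^sub>R a) = c * support_function C a"
proof -
  obtain x where x: "x \<in> C" "support_function C a = a \<bullet> x" "\<And>y. y \<in> C \<Longrightarrow> a \<bullet> y \<le> a \<bullet> x"
    using support_function_attained[OF assms(1)] by blast
  have "support_function C (c *\<^sub>R a) = c * (a \<bullet> x)"
    unfolding support_function_def using x assms(2)
    by (intro cSup_eq_maximum) (auto intro: mult_left_mono)
  with x show ?thesis by simp
qed

lemma continuous_on_support_function:
  fixes C :: "'a::euclidean_space set"
  assumes "convex_body0 C"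
  shows "continuous_on S (support_function C)"
proof -
  have "convex_on UNIV (support_function C)"
  proof (rule convex_onI)
    fix t :: real and a b :: 'a assume t: "0 < t" "t < 1"
    obtain x where x: "x \<in> C"
      "support_function C ((1 - t) *\<^sub>R a + t *\<^sub>R b) = ((1 - t) *\<^sub>R a + t *\<^sub>R b) \<bullet> x"
      using support_function_attained[OF assms] by metis
    have "(1 - t) * (a \<bullet> x) + t * (b \<bullet> x) \<le> (1 - t) * support_function C a + t * support_function C b"
      using t x inner_le_support_function[OF assms]
      by (intro add_mono mult_left_mono) auto
    with x show "support_function C ((1 - t) *\<^sub>R a + t *\<^sub>R b)
        \<le> (1 - t) * support_function C a + t * support_function C b"
      by (simp add: inner_left_distrib)
  qed simp
  then have "continuous_on UNIV (support_function C)"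
    by (intro convex_on_continuous) auto
  then show ?thesis by (rule continuous_on_subset) simp
qed

text \<open>By the separation theorem a body is the intersection of its supporting half-spaces; rescaling
  the separating functional lets unit normals suffice.\<close>

lemma mem_convex_body0_iff:
  fixes x :: "'a::euclidean_space"
  assumes "convex_body0 C"
  shows "x \<in> C \<longleftrightarrow> (\<forall>a\<in>sphere 0 1. a \<bullet> x \<le> support_function C a)"
proof
  show "x \<in> C \<Longrightarrow> \<forall>a\<in>sphere 0 1. a \<bullet> x \<le> support_function C a"
    using inner_le_support_function[OF assms] by blast
next
  assume *: "\<forall>a\<in>sphere 0 1. a \<bullet> x \<le> support_function C a"
  show "x \<in> C"
  proof (rule ccontr)
    assume "x \<notin> C"
    have "convex C" "closed C" using assms by (auto simp: convex_body0_def compact_imp_closed)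
    then obtain a b where ab: "a \<bullet> x < b" "\<forall>y\<in>C. b < a \<bullet> y"
      using separating_hyperplane_closed_point \<open>x \<notin> C\<close> by blast
    obtain y where y: "y \<in> C" "support_function C (- a) = (- a) \<bullet> y"
      using support_function_attained[OF assms] by metis
    have "a \<noteq> 0" using ab y(1) by fastforce
    define u where "u = (1 / norm a) *\<^sub>R (- a)"
    have "u \<in> sphere 0 1" using \<open>a \<noteq> 0\<close> by (simp add: u_def)
    then have "u \<bullet> x \<le> support_function C u" using * by blast
    also have "\<dots> = (1 / norm a) * ((- a) \<bullet> y)"
      unfolding u_def support_function_scaleR[OF assms, of "1 / norm a", simplified] y(2) by simp
    finally have "(- a) \<bullet> x \<le> (- a) \<bullet> y"
      using \<open>a \<noteq> 0\<close> by (simp add: u_def divide_le_cancel)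
    moreover have "b < a \<bullet> y" using ab y by blast
    ultimately show False using ab by simp
  qed
qed

text \<open>The parameters \<open>s \<ge> 0\<close> with \<open>s v \<in> C\<close> form a compact interval starting at \<open>0\<close> and not reduced
  to \<open>0\<close>, since \<open>0\<close> is interior to \<open>C\<close>. The gauge of \<open>v\<close> is the inverse of its right end point.\<close>

lemma radial_function:
  fixes v :: "'a::euclidean_space"
  assumes "convex_body0 C" "v \<noteq> 0"
  shows radial_function_pos: "0 < inverse (gauge_function C v)"
    and scaleR_mem_iff_le_radial: "0 \<le> s \<Longrightarrow> s *\<^sub>R v \<in> C \<longleftrightarrow> s \<le> inverse (gauge_function C v)"
proof -
  define A where "A = {s::real. 0 \<le> s \<and> s *\<^sub>R v \<in> C}"
  have C: "compact C" "convex C" "0 \<in> interior C" using assms by (auto simp: convex_body0_def)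
  then have "0 \<in> C" using interior_subset by blast
  obtain e where e: "e > 0" "cball 0 e \<subseteq> C" using C mem_interior_cball by blast
  have eA: "e / norm v \<in> A" using e assms by (auto simp: A_def subset_iff)
  have "closed A"
  proof -
    have "closed ((\<lambda>s. s *\<^sub>R v) -` C)"
      using C by (intro closed_vimage compact_imp_closed continuous_intros)
    moreover have "A = {0..} \<inter> (\<lambda>s. s *\<^sub>R v) -` C" by (auto simp: A_def)
    ultimately show ?thesis by auto
  qed
  moreover have "bounded A"
  proof -
    obtain R where R: "\<And>x. x \<in> C \<Longrightarrow> norm x \<le> R"
      using C compact_imp_bounded bounded_iff by metis
    have "norm s \<le> R / norm v" if "s \<in> A" for s
      using R[of "s *\<^sub>R v"] that assms by (simp add: A_def field_simps)
    then show ?thesis unfolding bounded_iff by blast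
  qed
  ultimately have "compact A" by (simp add: compact_eq_bounded_closed)
  then obtain r where r: "r \<in> A" "\<And>s. s \<in> A \<Longrightarrow> s \<le> r"
    using compact_attains_sup[of A] eA by blast
  have "e / norm v > 0" using e assms by simp
  then have "r > 0" using r(2)[OF eA] by linarith
  have "gauge_function C v = inverse r"
    unfolding gauge_function_def
  proof (rule cInf_eq_minimum)
    have "r *\<^sub>R v \<in> C" using r(1) by (simp add: A_def)
    then have "v \<in> (*\<^sub>R) (inverse r) ` C"
      using \<open>r > 0\<close> by (intro image_eqI[of _ _ "r *\<^sub>R v"]) auto
    then show "inverse r \<in> {t. 0 \<le> t \<and> v \<in> (*\<^sub>R) t ` C}"
      using \<open>r > 0\<close> by simp
  next
    fix t assume "t \<in> {t. 0 \<le> t \<and> v \<in> (*\<^sub>R) t ` C}"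
    then obtain y where y: "0 \<le> t" "y \<in> C" "v = t *\<^sub>R y" by blast
    with assms have "t > 0" by (cases "t = 0") auto
    then have "inverse t \<in> A" using y by (simp add: A_def)
    then have "inverse t \<le> r" by (rule r)
    then show "inverse r \<le> t" using \<open>t > 0\<close> \<open>r > 0\<close> by (simp add: field_simps)
  qed
  then have g: "inverse (gauge_function C v) = r" by simp
  then show "0 < inverse (gauge_function C v)" using \<open>r > 0\<close> by simp
  assume s: "0 \<le> s"
  show "s *\<^sub>R v \<in> C \<longleftrightarrow> s \<le> inverse (gauge_function C v)"
  proof
    assume "s *\<^sub>R v \<in> C" then show "s \<le> inverse (gauge_function C v)"
      using s r(2)[of s] g by (simp add: A_def)
  next
    assume "s \<le> inverse (gauge_function C v)"
    then have "s \<le> r" using g by simp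
    have "(s / r) *\<^sub>R (r *\<^sub>R v) + (1 - s / r) *\<^sub>R 0 \<in> C"
      using r(1) s \<open>s \<le> r\<close> \<open>r > 0\<close> \<open>0 \<in> C\<close> by (intro convexD[OF C(2)]) (auto simp: A_def)
    then show "s *\<^sub>R v \<in> C" using \<open>r > 0\<close> by simp
  qed
qed

lemma radial_inner_le_support_function:
  fixes v :: "'a::euclidean_space"
  assumes "convex_body0 C" "v \<noteq> 0"
  shows "inverse (gauge_function C v) * (a \<bullet> v) \<le> support_function C a"
  using inner_le_support_function[OF assms(1), of "inverse (gauge_function C v) *\<^sub>R v" a]
    scaleR_mem_iff_le_radial[OF assms, of "inverse (gauge_function C v)"]
    radial_function_pos[OF assms] by simp

section \<open>The inclusion\<close>

lemma convex_upper_mean: "convex (upper_mean p K L)"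
proof -
  have "upper_mean p K L =
      (\<Inter>a\<in>sphere 0 1. {x. a \<bullet> x \<le> p_mean p (support_function K a) (support_function L a)})"
    by (auto simp: upper_mean_def)
  then show ?thesis by (simp add: convex_INT convex_halfspace_le)
qed

text \<open>As the upper mean is convex, only the generators of the lower mean have to be checked. When
  \<open>a \<bullet> v > 0\<close> the factor \<open>a \<bullet> v\<close> can be moved inside the mean; otherwise the left-hand side is
  nonpositive.\<close>

lemma lower_mean_subset_upper_mean:
  fixes K L :: "'a::euclidean_space set"
  assumes K: "convex_body0 K" and L: "convex_body0 L"
  shows "lower_mean p K L \<subseteq> upper_mean p K L"
  unfolding lower_mean_def
proof (rule hull_minimal[where S = convex], rule image_subsetI)
  fix v :: 'a assume "v \<in> sphere 0 1"
  then have v: "v \<noteq> 0" by auto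
  let ?k = "inverse (gauge_function K v)" and ?l = "inverse (gauge_function L v)"
  have pos: "?k > 0" "?l > 0" using radial_function_pos v K L by blast+
  show "p_mean p ?k ?l *\<^sub>R v \<in> upper_mean p K L"
    unfolding upper_mean_def
  proof (intro CollectI ballI)
    fix a :: 'a assume "a \<in> sphere 0 1"
    then have a: "a \<noteq> 0" by auto
    show "a \<bullet> p_mean p ?k ?l *\<^sub>R v \<le> p_mean p (support_function K a) (support_function L a)"
    proof (cases "a \<bullet> v > 0")
      case True
      then have "a \<bullet> p_mean p ?k ?l *\<^sub>R v = p_mean p ((a \<bullet> v) * ?k) ((a \<bullet> v) * ?l)"
        by (simp only: p_mean_mult[OF True pos]) simp
      also have "\<dots> \<le> p_mean p (support_function K a) (support_function L a)"
        using True pos radial_inner_le_support_function[OF K v, of a]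
          radial_inner_le_support_function[OF L v, of a]
        by (intro p_mean_mono) (auto simp: mult.commute)
      finally show ?thesis .
    next
      case False
      have "p_mean p ?k ?l * (a \<bullet> v) \<le> 0"
        using False p_mean_pos[OF pos, of p] by (simp add: mult_le_0_iff)
      moreover have "0 < p_mean p (support_function K a) (support_function L a)"
        using K L a by (intro p_mean_pos support_function_pos)
      ultimately show ?thesis by simp
    qed
  qed
qed (rule convex_upper_mean)

section \<open>The cases of equality\<close>

text \<open>The lower mean is star-shaped about the origin: \<open>s v\<close> lies between the generators in
  the opposite directions \<open>v\<close> and \<open>- v\<close>.\<close>

lemma scaleR_mem_lower_mean:
  fixes v :: "'a::euclidean_space"
  assumes K: "convex_body0 K" and L: "convex_body0 L"
    and v: "norm v = 1"
    and s: "0 \<le> s" "s \<le> p_mean p (inverse (gauge_function K v)) (inverse (gauge_function L v))"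
  shows "s *\<^sub>R v \<in> lower_mean p K L"
proof -
  let ?m = "\<lambda>v. p_mean p (inverse (gauge_function K v)) (inverse (gauge_function L v))"
  have mem: "?m u *\<^sub>R u \<in> lower_mean p K L" if "norm u = 1" for u
    unfolding lower_mean_def using that by (intro hull_inc imageI) simp
  have pos: "?m u > 0" if "norm u = 1" for u
  proof -
    have "u \<noteq> 0" using that by auto
    then show ?thesis using K L by (intro p_mean_pos radial_function_pos)
  qed
  define m m' where "m = ?m v" and "m' = ?m (- v)"
  have m: "m > 0" "m' > 0" "s \<le> m"
    using pos[of v] pos[of "- v"] v s by (auto simp: m_def m'_def)
  define t where "t = (s + m') / (m + m')"
  have t: "0 \<le> t" "t \<le> 1" using m s by (auto simp: t_def)
  have "t * (m + m') = s + m'" using m by (simp add: t_def)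
  then have st: "t * m - (1 - t) * m' = s" by (simp add: algebra_simps)
  have "t *\<^sub>R (m *\<^sub>R v) + (1 - t) *\<^sub>R (m' *\<^sub>R (- v)) \<in> lower_mean p K L"
  proof (rule convexD)
    show "convex (lower_mean p K L)" by (simp add: lower_mean_def)
    show "m *\<^sub>R v \<in> lower_mean p K L" "m' *\<^sub>R (- v) \<in> lower_mean p K L"
      using mem[of v] mem[of "- v"] v by (auto simp: m_def m'_def)
  qed (use t in auto)
  also have "t *\<^sub>R (m *\<^sub>R v) + (1 - t) *\<^sub>R (m' *\<^sub>R (- v)) = (t * m - (1 - t) * m') *\<^sub>R v"
    by (simp add: scaleR_left_diff_distrib)
  finally show ?thesis unfolding st .
qed

lemma upper_mean_subset_lower_meanI:
  fixes K L :: "'a::euclidean_space set"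
  assumes K: "convex_body0 K" and L: "convex_body0 L"
    and le: "\<And>v s. norm v = 1 \<Longrightarrow> 0 < s \<Longrightarrow> s *\<^sub>R v \<in> upper_mean p K L \<Longrightarrow>
      s \<le> p_mean p (inverse (gauge_function K v)) (inverse (gauge_function L v))"
  shows "upper_mean p K L \<subseteq> lower_mean p K L"
proof
  fix x assume x: "x \<in> upper_mean p K L"
  show "x \<in> lower_mean p K L"
  proof (cases "x = 0")
    case True
    obtain v :: 'a where v: "norm v = 1" using vector_choose_size[of 1] by auto
    then have "v \<noteq> 0" by auto
    then have "0 < p_mean p (inverse (gauge_function K v)) (inverse (gauge_function L v))"
      using K L by (intro p_mean_pos radial_function_pos)
    then show ?thesis using scaleR_mem_lower_mean[OF K L v, of 0 p] True by simp
  next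
    case False
    have "norm x *\<^sub>R ((1 / norm x) *\<^sub>R x) \<in> lower_mean p K L"
      using False x le[of "(1 / norm x) *\<^sub>R x" "norm x"]
      by (intro scaleR_mem_lower_mean[OF K L]) auto
    then show ?thesis using False by simp
  qed
qed

lemma upper_mean_subset_lower_mean_minus_infinity:
  fixes K L :: "'a::euclidean_space set"
  assumes K: "convex_body0 K" and L: "convex_body0 L"
  shows "upper_mean (-\<infinity>) K L \<subseteq> lower_mean (-\<infinity>) K L"
proof (rule upper_mean_subset_lower_meanI[OF K L])
  fix v :: 'a and s :: real
  assume v: "norm v = 1" and s: "0 < s" and u: "s *\<^sub>R v \<in> upper_mean (-\<infinity>) K L"
  have "s *\<^sub>R v \<in> K" "s *\<^sub>R v \<in> L"
    using u unfolding mem_convex_body0_iff[OF K] mem_convex_body0_iff[OF L]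
    by (auto simp: upper_mean_def p_mean_simps)
  moreover have "v \<noteq> 0" using v by auto
  ultimately show "s \<le> p_mean (-\<infinity>) (inverse (gauge_function K v)) (inverse (gauge_function L v))"
    using scaleR_mem_iff_le_radial[OF K _ less_imp_le[OF s]]
      scaleR_mem_iff_le_radial[OF L _ less_imp_le[OF s]] by (simp add: p_mean_simps)
qed

lemma convex_body0_convex_hull_Un:
  assumes "convex_body0 K" "convex_body0 L"
  shows "convex_body0 (convex hull (K \<union> L))"
  unfolding convex_body0_def
proof (intro conjI)
  show "compact (convex hull (K \<union> L))"
    using assms by (intro compact_convex_hull compact_Un) (auto simp: convex_body0_def)
  have "K \<subseteq> convex hull (K \<union> L)" by (auto intro: hull_inc)
  then show "0 \<in> interior (convex hull (K \<union> L))"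
    using assms(1) interior_mono unfolding convex_body0_def by blast
qed simp

text \<open>Both \<open>K\<close> and \<open>L\<close> lie in the lower mean because the radial function of each is below the
  maximum. The support function of the convex hull of \<open>K \<union> L\<close> dominates the maximum of those of
  \<open>K\<close> and \<open>L\<close>, so the upper mean lies in this hull.\<close>

lemma upper_mean_subset_lower_mean_infinity:
  fixes K L :: "'a::euclidean_space set"
  assumes K: "convex_body0 K" and L: "convex_body0 L"
  shows "upper_mean \<infinity> K L \<subseteq> lower_mean \<infinity> K L"
proof -
  have sub: "C \<subseteq> lower_mean \<infinity> K L" if C: "C = K \<or> C = L" for C
  proof
    fix x assume x: "x \<in> C"
    have body: "convex_body0 C" using C K L by auto
    show "x \<in> lower_mean \<infinity> K L"
    proof (cases "x = 0")
      case True
      obtain v :: 'a where v: "norm v = 1" using vector_choose_size[of 1] by auto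
      then have "v \<noteq> 0" by auto
      then have "0 < inverse (gauge_function K v)" using K by (intro radial_function_pos)
      then show ?thesis using scaleR_mem_lower_mean[OF K L v, of 0 \<infinity>] True
        by (simp add: p_mean_simps le_max_iff_disj)
    next
      case False
      let ?v = "(1 / norm x) *\<^sub>R x"
      have nz: "?v \<noteq> 0" using False by simp
      have "norm x *\<^sub>R ?v \<in> C" using x False by simp
      then have "norm x \<le> inverse (gauge_function C ?v)"
        using scaleR_mem_iff_le_radial[OF body nz, of "norm x"] by simp
      then have "norm x *\<^sub>R ?v \<in> lower_mean \<infinity> K L"
        using C False by (intro scaleR_mem_lower_mean[OF K L]) (auto simp: p_mean_simps)
      then show ?thesis using False by simp
    qed
  qed
  let ?C = "convex hull (K \<union> L)"
  have C: "convex_body0 ?C" using K L by (rule convex_body0_convex_hull_Un)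
  have "upper_mean \<infinity> K L \<subseteq> ?C"
  proof
    fix x assume x: "x \<in> upper_mean \<infinity> K L"
    have mono: "support_function K a \<le> support_function ?C a"
      "support_function L a \<le> support_function ?C a" for a
      by (metis C K L UnI1 UnI2 hull_inc inner_le_support_function support_function_attained)+
    show "x \<in> ?C"
      unfolding mem_convex_body0_iff[OF C]
    proof
      fix a :: 'a assume "a \<in> sphere 0 1"
      then have "a \<bullet> x \<le> max (support_function K a) (support_function L a)"
        using x by (auto simp: upper_mean_def p_mean_simps)
      then show "a \<bullet> x \<le> support_function ?C a" using mono[of a] by linarith
    qed
  qed
  also have "?C \<subseteq> lower_mean \<infinity> K L"
    using sub by (intro hull_minimal) (auto simp: lower_mean_def)
  finally show ?thesis .
qed

text \<open>For \<open>L = t K\<close> homogeneity makes both means equal to \<open>c K\<close>, where \<open>c\<close> is the mean of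
  \<open>1\<close> and \<open>t\<close>.\<close>

lemma upper_mean_subset_lower_mean_dilates:
  fixes K L :: "'a::euclidean_space set"
  assumes K: "convex_body0 K" and L: "convex_body0 L" and "dilates K L"
  shows "upper_mean p K L \<subseteq> lower_mean p K L"
proof (rule upper_mean_subset_lower_meanI[OF K L])
  obtain t where t: "t > 0" and Lt: "L = (\<lambda>y. t *\<^sub>R y) ` K"
    using assms(3) by (auto simp: dilates_def)
  have mem_L: "t *\<^sub>R x \<in> L \<longleftrightarrow> x \<in> K" for x
    using t unfolding Lt by (auto simp: image_iff)
  define c where "c = p_mean p 1 t"
  have c: "c > 0" unfolding c_def using t by (intro p_mean_pos) auto
  have mean: "p_mean p x (t * x) = c * x" if "x > 0" for x
    using p_mean_mult[of x 1 t p] that t by (simp add: c_def mult.commute)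
  have supp: "support_function L a = t * support_function K a" for a
  proof (rule antisym)
    obtain x where "x \<in> L" "support_function L a = a \<bullet> x"
      using support_function_attained[OF L] by metis
    then show "support_function L a \<le> t * support_function K a"
      using inner_le_support_function[OF K, of _ a] t unfolding Lt by auto
    obtain x where "x \<in> K" "support_function K a = a \<bullet> x"
      using support_function_attained[OF K] by metis
    then show "t * support_function K a \<le> support_function L a"
      using inner_le_support_function[OF L, of "t *\<^sub>R x" a] mem_L by simp
  qed
  fix v :: 'a and s :: real
  assume v: "norm v = 1" and s: "0 < s" and u: "s *\<^sub>R v \<in> upper_mean p K L"
  have v0: "v \<noteq> 0" using v by auto
  let ?k = "inverse (gauge_function K v)" and ?l = "inverse (gauge_function L v)"
  have k: "?k > 0" and l: "?l > 0" using radial_function_pos v0 K L by blast+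
  have "(t * ?k) *\<^sub>R v \<in> L"
    using mem_L[of "?k *\<^sub>R v"] scaleR_mem_iff_le_radial[OF K v0, of ?k] k by simp
  then have kl: "t * ?k \<le> ?l"
    using scaleR_mem_iff_le_radial[OF L v0, of "t * ?k"] t k by simp
  have "(s / c) *\<^sub>R v \<in> K"
    unfolding mem_convex_body0_iff[OF K]
  proof
    fix a :: 'a assume a: "a \<in> sphere 0 1"
    then have "a \<noteq> 0" by auto
    then have "0 < support_function K a" by (rule support_function_pos[OF K])
    then have "p_mean p (support_function K a) (support_function L a) = c * support_function K a"
      unfolding supp by (rule mean)
    moreover have "a \<bullet> (s *\<^sub>R v) \<le> p_mean p (support_function K a) (support_function L a)"
      using u a unfolding upper_mean_def by blast
    ultimately have "a \<bullet> (s *\<^sub>R v) \<le> c * support_function K a" by simp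
    then show "a \<bullet> (s / c) *\<^sub>R v \<le> support_function K a"
      using c by (simp add: field_simps)
  qed
  then have "s / c \<le> ?k" using scaleR_mem_iff_le_radial[OF K v0, of "s / c"] s c by simp
  then have "s \<le> c * ?k" using c by (simp add: field_simps)
  also have "\<dots> = p_mean p ?k (t * ?k)" using mean k by simp
  also have "\<dots> \<le> p_mean p ?k ?l" using k t kl by (intro p_mean_mono) auto
  finally show "s \<le> p_mean p ?k ?l" .
qed

text \<open>On a line the point of \<open>C\<close> that is maximal in the unit direction \<open>v\<close> is itself a multiple of
  \<open>v\<close>, so the support function does not exceed the radial function at unit vectors.\<close>

lemma upper_mean_subset_lower_mean_dim_1:
  fixes K L :: "'a::euclidean_space set"
  assumes K: "convex_body0 K" and L: "convex_body0 L" and dim: "DIM('a) = 1"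
  shows "upper_mean p K L \<subseteq> lower_mean p K L"
proof (rule upper_mean_subset_lower_meanI[OF K L])
  fix v :: 'a and s :: real
  assume v: "norm v = 1" and s: "0 < s" and u: "s *\<^sub>R v \<in> upper_mean p K L"
  have v0: "v \<noteq> 0" using v by auto
  obtain i :: 'a where i: "Basis = {i}" using dim card_1_singletonE by blast
  have line: "x = (v \<bullet> x) *\<^sub>R v" for x
  proof -
    have *: "y = (y \<bullet> i) *\<^sub>R i" for y
      using euclidean_representation[of y] unfolding i by simp
    have ii: "i \<bullet> i = 1" using i by (metis inner_same_Basis singletonI)
    define c where "c = v \<bullet> i"
    have vc: "v = c *\<^sub>R i" using *[of v] c_def by simp
    then have "c * c = 1" using v ii by (metis inner_scaleR_left inner_scaleR_right mult.right_neutral norm_eq_1)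
    define d where "d = x \<bullet> i"
    have "x = d *\<^sub>R i" using *[of x] d_def by simp
    then show ?thesis using vc ii \<open>c * c = 1\<close> by (simp add: mult.assoc mult.left_commute)
  qed
  have le: "support_function C v \<le> inverse (gauge_function C v)" if C: "convex_body0 C" for C
  proof -
    obtain x where "x \<in> C" "support_function C v = v \<bullet> x"
      using support_function_attained[OF C] by metis
    then have "support_function C v *\<^sub>R v \<in> C" using line[of x] by simp
    then show ?thesis
      using scaleR_mem_iff_le_radial[OF C v0] support_function_pos[OF C v0] by (simp add: less_imp_le)
  qed
  have "v \<bullet> (s *\<^sub>R v) \<le> p_mean p (support_function K v) (support_function L v)"
    using u v by (simp add: upper_mean_def)
  moreover have "v \<bullet> (s *\<^sub>R v) = s" using v by (simp add: norm_eq_1)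
  moreover have "p_mean p (support_function K v) (support_function L v)
      \<le> p_mean p (inverse (gauge_function K v)) (inverse (gauge_function L v))"
    using le K L v0 by (intro p_mean_mono support_function_pos)
  ultimately show "s \<le> p_mean p (inverse (gauge_function K v)) (inverse (gauge_function L v))"
    by (metis order_trans)
qed

section \<open>Equality forces parallel contact points\<close>

lemma compact_upper_mean:
  fixes K L :: "'a::euclidean_space set"
  assumes K: "convex_body0 K" and L: "convex_body0 L"
  shows "compact (upper_mean (ereal r) K L)"
proof -
  let ?f = "\<lambda>a. p_mean (ereal r) (support_function K a) (support_function L a)"
  have "upper_mean (ereal r) K L = (\<Inter>a\<in>sphere 0 1. {x. a \<bullet> x \<le> ?f a})"
    by (auto simp: upper_mean_def)
  then have "closed (upper_mean (ereal r) K L)" by (simp add: closed_INT closed_halfspace_le)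
  moreover have "bounded (upper_mean (ereal r) K L)"
  proof -
    have "continuous_on (sphere 0 1) ?f"
      using K L by (intro continuous_on_p_mean continuous_on_support_function support_function_pos) auto
    moreover have "sphere (0::'a) 1 \<noteq> {}" by simp
    ultimately obtain B where B: "\<forall>a\<in>sphere 0 1. ?f a \<le> ?f B"
      using continuous_attains_sup[of "sphere 0 1" ?f] by auto
    have "norm x \<le> max 0 (?f B)" if x: "x \<in> upper_mean (ereal r) K L" for x
    proof (cases "x = 0")
      case False
      define a where "a = (1 / norm x) *\<^sub>R x"
      have a: "a \<in> sphere 0 1" using False by (simp add: a_def)
      have "a \<bullet> x = norm x"
        using False by (simp add: a_def power2_norm_eq_inner[symmetric] power2_eq_square)
      moreover have "a \<bullet> x \<le> ?f a" using x a by (auto simp: upper_mean_def)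
      ultimately show ?thesis using B a by force
    qed auto
    then show ?thesis unfolding bounded_iff by blast
  qed
  ultimately show ?thesis by (simp add: compact_eq_bounded_closed)
qed

text \<open>The polar of the set \<open>{x. \<forall>b. b \<bullet> x \<le> f b}\<close> is the convex hull of the points \<open>b / f(b)\<close>.
  Otherwise a hyperplane separates some polar point \<open>c\<close> from this compact hull. Its normal,
  suitably scaled, then satisfies all the inequalities, although its product with \<open>c\<close> exceeds \<open>1\<close>.\<close>

lemma mem_convex_hull_polar_generators:
  fixes f :: "'a::euclidean_space \<Rightarrow> real"
  assumes cont: "continuous_on (sphere 0 1) f" and pos: "\<And>b. b \<in> sphere 0 1 \<Longrightarrow> 0 < f b"
    and le: "\<And>x. (\<forall>b\<in>sphere 0 1. b \<bullet> x \<le> f b) \<Longrightarrow> c \<bullet> x \<le> 1"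
  shows "c \<in> convex hull ((\<lambda>b. (1 / f b) *\<^sub>R b) ` sphere 0 1)" (is "c \<in> convex hull ?S")
proof (rule ccontr)
  assume c: "c \<notin> convex hull ?S"
  have "compact ?S"
    using cont pos by (intro compact_continuous_image continuous_intros) force+
  then have "closed (convex hull ?S)" by (simp add: compact_convex_hull compact_imp_closed)
  then obtain z \<beta> where z: "z \<bullet> c < \<beta>" "\<forall>y\<in>convex hull ?S. \<beta> < z \<bullet> y"
    using separating_hyperplane_closed_point[of "convex hull ?S" c] c by auto
  have S: "\<beta> * f b < z \<bullet> b" if "b \<in> sphere 0 1" for b
  proof -
    have "(1 / f b) *\<^sub>R b \<in> convex hull ?S" using that by (intro hull_inc imageI)
    then have "\<beta> < z \<bullet> ((1 / f b) *\<^sub>R b)" using z by blast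
    then show ?thesis using pos[OF that] by (simp add: field_simps)
  qed
  (* The hull contains a pair of points in opposite directions, so z takes a nonpositive value on it. *)
  have "\<beta> < 0"
  proof (rule ccontr)
    assume "\<not> \<beta> < 0"
    obtain b :: 'a where b: "b \<in> sphere 0 1" using vector_choose_size[of 1] by auto
    then have nb: "- b \<in> sphere 0 1" by simp
    have "0 \<le> \<beta> * f b" "0 \<le> \<beta> * f (- b)"
      using \<open>\<not> \<beta> < 0\<close> pos[OF b] pos[OF nb] by auto
    then show False using S[OF b] S[OF nb] by auto
  qed
  have "c \<bullet> ((1 / \<beta>) *\<^sub>R z) \<le> 1"
  proof (rule le, rule ballI)
    fix b :: 'a assume "b \<in> sphere 0 1"
    then show "b \<bullet> (1 / \<beta>) *\<^sub>R z \<le> f b"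
      using S[of b] \<open>\<beta> < 0\<close> by (simp add: inner_commute field_simps)
  qed
  then show False using z(1) \<open>\<beta> < 0\<close> by (simp add: inner_commute field_simps)
qed

text \<open>Equality of the two means makes every linear functional attain its maxima over \<open>K\<close> and over
  \<open>L\<close> on a common ray, the ray through an extreme point of the face of the common mean in that
  direction.\<close>

lemma parallel_contact_points:
  fixes K L :: "'a::euclidean_space set"
  assumes K: "convex_body0 K" and L: "convex_body0 L"
    and eq: "lower_mean (ereal r) K L = upper_mean (ereal r) K L"
    and a: "norm a = 1"
  obtains v where "norm v = 1" "0 < a \<bullet> v"
    "support_function K a = inverse (gauge_function K v) * (a \<bullet> v)"
    "support_function L a = inverse (gauge_function L v) * (a \<bullet> v)"
proof -
  let ?M = "upper_mean (ereal r) K L"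
  let ?f = "\<lambda>b. p_mean (ereal r) (support_function K b) (support_function L b)"
  let ?m = "\<lambda>v. p_mean (ereal r) (inverse (gauge_function K v)) (inverse (gauge_function L v))"
  have a0: "a \<noteq> 0" using a by auto
  have aM: "?m a *\<^sub>R a \<in> ?M"
    unfolding eq[symmetric] lower_mean_def using a by (intro hull_inc imageI) simp
  have ma: "?m a > 0" using K L a0 by (intro p_mean_pos radial_function_pos)
  have M: "compact ?M" "convex ?M" using K L compact_upper_mean convex_upper_mean by blast+
  have "?M \<noteq> {}" using aM by blast
  then obtain x0 where x0: "x0 \<in> ?M" "\<forall>y\<in>?M. a \<bullet> y \<le> a \<bullet> x0"
    using continuous_attains_sup[OF M(1) _ continuous_on_inner[OF continuous_on_const continuous_on_id]]
    by auto
  define h where "h = a \<bullet> x0"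
  have "a \<bullet> (?m a *\<^sub>R a) \<le> h" using x0 aM by (auto simp: h_def)
  then have h: "h > 0" using ma a by (simp add: norm_eq_1)
  let ?F = "?M \<inter> {y. a \<bullet> y = h}"
  have "?F face_of ?M" using x0 M by (intro face_of_Int_supporting_hyperplane_le) (auto simp: h_def)
  have "compact ?F" "convex ?F"
    using M by (auto intro!: compact_Int_closed convex_Int simp: closed_hyperplane convex_hyperplane)
  moreover have "?F \<noteq> {}" using x0 by (auto simp: h_def)
  ultimately obtain x where x: "x extreme_point_of ?F"
    using extreme_point_exists_convex by blast
  then have xe: "x extreme_point_of ?M" and ax: "a \<bullet> x = h"
    using extreme_point_of_face[OF \<open>?F face_of ?M\<close>] by auto
  from xe have "x \<in> (\<lambda>v. ?m v *\<^sub>R v) ` sphere 0 1"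
    unfolding eq[symmetric] lower_mean_def by (rule extreme_point_of_convex_hull)
  then obtain v where v: "norm v = 1" "x = ?m v *\<^sub>R v" by auto
  have v0: "v \<noteq> 0" using v by auto
  let ?k = "inverse (gauge_function K v)" and ?l = "inverse (gauge_function L v)"
  have pos: "?k > 0" "?l > 0" using radial_function_pos v0 K L by blast+
  have mv: "?m v > 0" using pos by (rule p_mean_pos)
  have xM: "x \<in> ?M" using x by (auto simp: extreme_point_of_def)
  (* The defining inequality for b is tight at x only if both inequalities that were averaged to
     obtain it are tight. *)
  have contact: "support_function K b = ?k * (b \<bullet> v) \<and> support_function L b = ?l * (b \<bullet> v)"
    if b: "b \<in> sphere 0 1" "b \<bullet> x = ?f b" for b
  proof -
    have "b \<noteq> 0" using b by auto
    then have f: "?f b > 0" using K L by (intro p_mean_pos support_function_pos)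
    moreover have "?m v * (b \<bullet> v) = ?f b" using b(2) v(2) by simp
    ultimately have bv: "b \<bullet> v > 0" using mv by (metis zero_less_mult_pos)
    have le: "(b \<bullet> v) * ?k \<le> support_function K b" "(b \<bullet> v) * ?l \<le> support_function L b"
      using radial_inner_le_support_function[OF K v0, of b]
        radial_inner_le_support_function[OF L v0, of b] by (auto simp: mult.commute)
    have "p_mean (ereal r) ((b \<bullet> v) * ?k) ((b \<bullet> v) * ?l) = ?f b"
      using p_mean_mult[OF bv pos, of "ereal r"] b v by (simp add: mult.commute)
    then have "\<not> ((b \<bullet> v) * ?k < support_function K b \<or> (b \<bullet> v) * ?l < support_function L b)"
      using p_mean_strict_mono[OF _ _ le, of r] bv pos by (metis less_irrefl mult_pos_pos)
    then show ?thesis using le by (auto simp: mult.commute)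
  qed
  have "(1 / h) *\<^sub>R a \<in> convex hull ((\<lambda>b. (1 / ?f b) *\<^sub>R b) ` sphere 0 1)"
  proof (rule mem_convex_hull_polar_generators)
    show "continuous_on (sphere 0 1) ?f"
      using K L by (intro continuous_on_p_mean continuous_on_support_function support_function_pos) auto
    show "0 < ?f b" if "b \<in> sphere 0 1" for b
      using K L that by (intro p_mean_pos support_function_pos) auto
    fix y assume "\<forall>b\<in>sphere 0 1. b \<bullet> y \<le> ?f b"
    then have "y \<in> ?M" by (auto simp: upper_mean_def)
    then have "a \<bullet> y \<le> h" using x0 by (auto simp: h_def)
    then show "(1 / h) *\<^sub>R a \<bullet> y \<le> 1" using h by simp
  qed
  then obtain S u where S: "finite S" "S \<subseteq> (\<lambda>b. (1 / ?f b) *\<^sub>R b) ` sphere 0 1"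
      "\<forall>s\<in>S. 0 \<le> u s" "sum u S = 1" "(\<Sum>s\<in>S. u s *\<^sub>R s) = (1 / h) *\<^sub>R a"
    unfolding convex_hull_explicit by auto
  have le1: "s \<bullet> x \<le> 1" if s: "s \<in> S" for s
  proof -
    obtain b where b: "b \<in> sphere 0 1" "s = (1 / ?f b) *\<^sub>R b" using S(2) s by blast
    have "b \<noteq> 0" using b by auto
    then have "?f b > 0" using K L by (intro p_mean_pos support_function_pos)
    then show ?thesis using b xM by (auto simp: upper_mean_def)
  qed
  (* The functional a / h takes the value 1 at x, while the points s of which it is an average take
     values at most 1: those with positive weight take the value 1. *)
  have "(\<Sum>s\<in>S. u s * (1 - s \<bullet> x)) = 1 - (\<Sum>s\<in>S. u s *\<^sub>R s) \<bullet> x"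
    using S(4) by (simp add: right_diff_distrib sum_subtractf inner_sum_left)
  also have "\<dots> = 0" using S(5) ax h by simp
  finally have "\<forall>s\<in>S. u s * (1 - s \<bullet> x) = 0"
    using S(1,3) le1 by (subst (asm) sum_nonneg_eq_0_iff) auto
  then have eq1: "s \<bullet> x = 1" if "s \<in> S" "u s \<noteq> 0" for s using that by auto
  (* Maximality over C at the multiple of v passes from the tight directions to their combination a. *)
  have bound: "a \<bullet> y \<le> a \<bullet> (inverse (gauge_function C v) *\<^sub>R v)"
    if C: "C = K \<or> C = L" and y: "y \<in> C" for C y
  proof -
    let ?d = "inverse (gauge_function C v) *\<^sub>R v - y"
    have body: "convex_body0 C" using C K L by auto
    have "0 \<le> u s * (s \<bullet> ?d)" if s: "s \<in> S" for s
    proof (cases "u s = 0")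
      case False
      obtain b where b: "b \<in> sphere 0 1" "s = (1 / ?f b) *\<^sub>R b" using S(2) s by blast
      have "b \<noteq> 0" using b by auto
      then have f: "?f b > 0" using K L by (intro p_mean_pos support_function_pos)
      then have "b \<bullet> x = ?f b" using eq1[OF s False] b by (simp add: field_simps)
      then have "support_function C b = inverse (gauge_function C v) * (b \<bullet> v)"
        using contact[OF b(1)] C by auto
      then have "0 \<le> b \<bullet> ?d"
        using inner_le_support_function[OF body y, of b] by (simp add: inner_diff_right)
      then show ?thesis using b f S(3) s by simp
    qed simp
    then have "0 \<le> (\<Sum>s\<in>S. u s * (s \<bullet> ?d))" by (rule sum_nonneg)
    also have "\<dots> = (\<Sum>s\<in>S. u s *\<^sub>R s) \<bullet> ?d" by (simp add: inner_sum_left)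
    also have "\<dots> = (1 / h) * (a \<bullet> ?d)" using S(5) by simp
    finally have "0 \<le> a \<bullet> ?d" using h by (simp add: zero_le_divide_iff)
    then show ?thesis by (simp add: inner_diff_right)
  qed
  have supp: "support_function C a = inverse (gauge_function C v) * (a \<bullet> v)"
    if C: "C = K \<or> C = L" for C
  proof (rule antisym)
    have body: "convex_body0 C" using C K L by auto
    show "inverse (gauge_function C v) * (a \<bullet> v) \<le> support_function C a"
      by (rule radial_inner_le_support_function[OF body v0])
    obtain y where "y \<in> C" "support_function C a = a \<bullet> y"
      using support_function_attained[OF body] by metis
    then show "support_function C a \<le> inverse (gauge_function C v) * (a \<bullet> v)"
      using bound[OF C] by auto
  qed
  have "0 < ?m v * (a \<bullet> v)" using h ax v by simp
  then have "0 < a \<bullet> v" using mv by (simp add: zero_less_mult_iff)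
  then show thesis using that[OF v(1)] supp by blast
qed

section \<open>Parallel contact points force dilates\<close>

text \<open>The hypotheses say that \<open>\<omega> t * H t\<close> and \<open>\<omega> t * G t\<close> are subgradients of \<open>H\<close> and \<open>G\<close> at \<open>t\<close>,
  so that \<open>\<omega>\<close> plays the role of the derivative of both \<open>ln H\<close> and \<open>ln G\<close>, but it need not be
  continuous. Over a step from \<open>t\<close> to \<open>s\<close> of length \<open>d\<close> the ratio changes by at most a multiple of
  \<open>(\<omega> s - \<omega> t) * d + B\<^sup>2 * d\<^sup>2\<close>. Over \<open>N\<close> steps of length \<open>1 / N\<close> the differences of \<open>\<omega>\<close>
  telescope, so the total change is of order \<open>1 / N\<close>.\<close>

lemma ratio_const_if_common_log_subgradient:
  fixes H G \<omega> :: "real \<Rightarrow> real"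
  assumes cont: "continuous_on {0..1} H" "continuous_on {0..1} G"
    and pos: "\<And>t. t \<in> {0..1} \<Longrightarrow> 0 < H t" "\<And>t. t \<in> {0..1} \<Longrightarrow> 0 < G t"
    and bdd: "\<And>t. t \<in> {0..1} \<Longrightarrow> \<bar>\<omega> t\<bar> \<le> B"
    and H: "\<And>s t. s \<in> {0..1} \<Longrightarrow> t \<in> {0..1} \<Longrightarrow> H t * (1 + \<omega> t * (s - t)) \<le> H s"
    and G: "\<And>s t. s \<in> {0..1} \<Longrightarrow> t \<in> {0..1} \<Longrightarrow> G t * (1 + \<omega> t * (s - t)) \<le> G s"
  shows "H 0 / G 0 = H 1 / G 1"
proof -
  define \<phi> where "\<phi> t = H t / G t" for t
  have \<phi>_pos: "0 < \<phi> t" if "t \<in> {0..1}" for t using pos that by (simp add: \<phi>_def)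
  have "continuous_on {0..1} \<phi>"
    unfolding \<phi>_def using cont pos by (intro continuous_on_divide) force+
  then obtain t0 where t0: "\<forall>t\<in>{0..1}. \<phi> t \<le> \<phi> t0" "t0 \<in> {0..1}"
    using continuous_attains_sup[of "{0..1}" \<phi>] by auto
  define C where "C = \<phi> t0"
  have C: "0 < C" "\<And>t. t \<in> {0..1} \<Longrightarrow> \<phi> t \<le> C" using t0 \<phi>_pos by (auto simp: C_def)
  have B: "0 \<le> B" using bdd[of 0] by auto
  have step: "\<bar>\<phi> s - \<phi> t\<bar> \<le> C * ((\<omega> s - \<omega> t) * (s - t) + B\<^sup>2 * (s - t)\<^sup>2)"
    if st: "s \<in> {0..1}" "t \<in> {0..1}" "t \<le> s" "B * (s - t) \<le> 1" for s t
  proof -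
    define d where "d = s - t"
    have d: "0 \<le> d" "B * d \<le> 1" using st by (auto simp: d_def)
    define p q where "p = 1 + \<omega> t * d" and "q = 1 - \<omega> s * d"
    have "\<bar>\<omega> t * d\<bar> \<le> B * d" "\<bar>\<omega> s * d\<bar> \<le> B * d"
      using bdd st d by (auto simp: abs_mult intro: mult_right_mono)
    then have pq: "0 \<le> p" "0 \<le> q" using d unfolding p_def q_def by linarith+
    have ineq: "H t * p \<le> H s" "G t * p \<le> G s" "H s * q \<le> H t" "G s * q \<le> G t"
      using H[of s t] G[of s t] H[of t s] G[of t s] st
      by (auto simp: p_def q_def d_def algebra_simps)
    have "(H t * p) * (G s * q) \<le> H s * G t"
      using ineq pq pos st by (intro mult_mono) (auto simp: less_imp_le)
    then have 1: "\<phi> t * (p * q) \<le> \<phi> s"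
      using pos st by (simp add: \<phi>_def field_simps)
    have "(H s * q) * (G t * p) \<le> H t * G s"
      using ineq pq pos st by (intro mult_mono) (auto simp: less_imp_le)
    then have 2: "\<phi> s * (p * q) \<le> \<phi> t"
      using pos st by (simp add: \<phi>_def field_simps)
    (* The two estimates bound each of \<phi> s and \<phi> t from below by p * q times the other. *)
    have "p * q \<le> 1"
    proof (rule ccontr)
      assume *: "\<not> p * q \<le> 1"
      then have "\<phi> t < \<phi> t * (p * q)" "\<phi> s < \<phi> s * (p * q)" using \<phi>_pos st by auto
      then show False using 1 2 by linarith
    qed
    have "\<bar>\<phi> s - \<phi> t\<bar> \<le> C * (1 - p * q)"
    proof -
      have "\<phi> t * (1 - p * q) \<le> C * (1 - p * q)" "\<phi> s * (1 - p * q) \<le> C * (1 - p * q)"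
        using C st \<open>p * q \<le> 1\<close> by (auto intro!: mult_right_mono)
      then show ?thesis using 1 2 by (simp add: right_diff_distrib abs_le_iff)
    qed
    also have "\<dots> \<le> C * ((\<omega> s - \<omega> t) * d + B\<^sup>2 * d\<^sup>2)"
    proof (rule mult_left_mono)
      have "\<bar>\<omega> s\<bar> * \<bar>\<omega> t\<bar> \<le> B * B" using bdd st B by (intro mult_mono) auto
      then have "\<omega> s * \<omega> t \<le> B\<^sup>2" by (metis abs_le_D1 abs_mult power2_eq_square)
      then have "\<omega> s * \<omega> t * d\<^sup>2 \<le> B\<^sup>2 * d\<^sup>2" by (intro mult_right_mono) auto
      then show "1 - p * q \<le> (\<omega> s - \<omega> t) * d + B\<^sup>2 * d\<^sup>2"
        by (simp add: p_def q_def algebra_simps power2_eq_square)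
    qed (use C in simp)
    finally show ?thesis by (simp add: d_def)
  qed
  have bound: "\<bar>\<phi> 1 - \<phi> 0\<bar> \<le> C * (2 * B + B\<^sup>2) / real N" if N: "N > 0" "B \<le> real N" for N
  proof -
    let ?t = "\<lambda>i. real i / real N"
    have "\<bar>\<phi> 1 - \<phi> 0\<bar> = \<bar>\<Sum>i<N. \<phi> (?t (Suc i)) - \<phi> (?t i)\<bar>"
      using N sum_lessThan_telescope[of "\<lambda>i. \<phi> (?t i)" N] by simp
    also have "\<dots> \<le> (\<Sum>i<N. \<bar>\<phi> (?t (Suc i)) - \<phi> (?t i)\<bar>)" by (rule sum_abs)
    also have "\<dots> \<le> (\<Sum>i<N. C * ((\<omega> (?t (Suc i)) - \<omega> (?t i)) * (1 / N) + B\<^sup>2 * (1 / N)\<^sup>2))"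
    proof (rule sum_mono)
      fix i assume "i \<in> {..<N}"
      then have i: "?t (Suc i) \<in> {0..1}" "?t i \<in> {0..1}" "?t i \<le> ?t (Suc i)"
        by (auto simp: field_simps)
      have d: "?t (Suc i) - ?t i = 1 / N" by (simp add: diff_divide_distrib[symmetric])
      show "\<bar>\<phi> (?t (Suc i)) - \<phi> (?t i)\<bar>
          \<le> C * ((\<omega> (?t (Suc i)) - \<omega> (?t i)) * (1 / N) + B\<^sup>2 * (1 / N)\<^sup>2)"
        using step[OF i] N unfolding d by (simp add: field_simps)
    qed
    also have "\<dots> = C * ((\<Sum>i<N. \<omega> (?t (Suc i)) - \<omega> (?t i)) * (1 / N) + N * (B\<^sup>2 * (1 / N)\<^sup>2))"
      unfolding sum_distrib_left[symmetric] sum.distrib sum_distrib_right[symmetric] by simp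
    also have "(\<Sum>i<N. \<omega> (?t (Suc i)) - \<omega> (?t i)) = \<omega> 1 - \<omega> 0"
      using N sum_lessThan_telescope[of "\<lambda>i. \<omega> (?t i)" N] by simp
    also have "C * ((\<omega> 1 - \<omega> 0) * (1 / N) + N * (B\<^sup>2 * (1 / N)\<^sup>2)) = C * ((\<omega> 1 - \<omega> 0) + B\<^sup>2) / N"
      using N by (simp add: power2_eq_square field_simps)
    also have "\<dots> \<le> C * (2 * B + B\<^sup>2) / N"
      using C bdd[of 0] bdd[of 1] by (intro divide_right_mono mult_left_mono) auto
    finally show ?thesis .
  qed
  have "(\<lambda>N. C * (2 * B + B\<^sup>2) / real N) \<longlonglongrightarrow> 0"
    by (rule lim_const_over_n)
  moreover have "\<forall>\<^sub>F N in sequentially. \<bar>\<phi> 1 - \<phi> 0\<bar> \<le> C * (2 * B + B\<^sup>2) / real N"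
    using eventually_gt_at_top[of 0] eventually_ge_at_top[of "nat \<lceil>B\<rceil>"]
  proof eventually_elim
    case (elim N)
    then show ?case by (intro bound) linarith+
  qed
  ultimately have "\<bar>\<phi> 1 - \<phi> 0\<bar> \<le> 0"
    by (intro tendsto_lowerbound[of _ 0 sequentially]) auto
  then show ?thesis by (simp add: \<phi>_def)
qed

text \<open>Here \<open>w a\<close> is the direction of the common contact points for \<open>a\<close>, normalised by
  \<open>a \<bullet> w a = 1\<close>: the vectors \<open>h\<^sub>K(a) w a\<close> and \<open>h\<^sub>L(a) w a\<close> are subgradients at \<open>a\<close> of the support
  functions. Restricting to the segment gives the one-dimensional situation; \<open>\<omega>\<close> is bounded
  because \<open>h\<^sub>K\<close> has a positive minimum on the segment.\<close>

lemma support_function_ratio_const_on_segment: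
  fixes K L :: "'a::euclidean_space set"
  assumes K: "convex_body0 K" and L: "convex_body0 L"
    and w: "\<And>a. a \<noteq> 0 \<Longrightarrow> a \<bullet> w a = 1"
      "\<And>a b. a \<noteq> 0 \<Longrightarrow> support_function K a * (b \<bullet> w a) \<le> support_function K b"
      "\<And>a b. a \<noteq> 0 \<Longrightarrow> support_function L a * (b \<bullet> w a) \<le> support_function L b"
    and seg: "0 \<notin> closed_segment a b"
  shows "support_function K a / support_function L a = support_function K b / support_function L b"
proof -
  define \<gamma> where "\<gamma> t = a + t *\<^sub>R (b - a)" for t :: real
  define \<omega> where "\<omega> t = (b - a) \<bullet> w (\<gamma> t)" for t
  have nz: "\<gamma> t \<noteq> 0" if "t \<in> {0..1}" for t
  proof -
    have "\<gamma> t \<in> closed_segment a b"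
      using that by (auto simp: \<gamma>_def closed_segment_def algebra_simps intro!: exI[of _ t])
    then show ?thesis using seg by auto
  qed
  have cont: "continuous_on {0..1} (\<lambda>t. support_function C (\<gamma> t))" if "convex_body0 C" for C
    unfolding \<gamma>_def
    by (rule continuous_on_compose2[OF continuous_on_support_function[OF that, of UNIV]])
      (auto intro!: continuous_intros)
  have pos: "0 < support_function K (\<gamma> t)" "0 < support_function L (\<gamma> t)" if "t \<in> {0..1}" for t
    using K L nz that by (auto intro: support_function_pos)
  obtain t0 where t0: "t0 \<in> {0..1}"
    "\<And>t. t \<in> {0..1} \<Longrightarrow> support_function K (\<gamma> t0) \<le> support_function K (\<gamma> t)"
    using continuous_attains_inf[OF _ _ cont[OF K]] by auto
  define c where "c = support_function K (\<gamma> t0)"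
  define R where "R = max 0 (max (support_function K (b - a)) (support_function K (- (b - a))))"
  have bdd: "\<bar>\<omega> t\<bar> \<le> R / c" if t: "t \<in> {0..1}" for t
  proof -
    have c: "0 < c" "c \<le> support_function K (\<gamma> t)" using pos t0 t by (auto simp: c_def)
    have "support_function K (\<gamma> t) * \<omega> t \<le> R" "support_function K (\<gamma> t) * (- \<omega> t) \<le> R"
      using w(2)[OF nz[OF t], of "b - a"] w(2)[OF nz[OF t], of "- (b - a)"]
      by (auto simp: \<omega>_def R_def inner_diff_left le_max_iff_disj)
    then have "support_function K (\<gamma> t) * \<bar>\<omega> t\<bar> \<le> R" by (auto simp: abs_if)
    moreover have "c * \<bar>\<omega> t\<bar> \<le> support_function K (\<gamma> t) * \<bar>\<omega> t\<bar>"
      using c by (intro mult_right_mono) auto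
    ultimately show ?thesis using c by (simp add: field_simps)
  qed
  have lin: "\<gamma> s \<bullet> w (\<gamma> t) = 1 + \<omega> t * (s - t)" if "t \<in> {0..1}" for s t
  proof -
    have "\<gamma> s = \<gamma> t + (s - t) *\<^sub>R (b - a)" by (simp add: \<gamma>_def algebra_simps)
    then show ?thesis using w(1)[OF nz[OF that]] by (simp add: \<omega>_def inner_add_left)
  qed
  have "support_function K (\<gamma> 0) / support_function L (\<gamma> 0)
      = support_function K (\<gamma> 1) / support_function L (\<gamma> 1)"
    by (rule ratio_const_if_common_log_subgradient[where \<omega> = \<omega> and B = "R / c"])
      (use cont K L pos bdd w nz lin in \<open>auto simp flip: lin\<close>)
  then show ?thesis by (simp add: \<gamma>_def)
qed

lemma dilatesI_support_function:
  fixes K L :: "'a::euclidean_space set"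
  assumes K: "convex_body0 K" and L: "convex_body0 L" and c: "c > 0"
    and eq: "\<And>a. norm a = 1 \<Longrightarrow> support_function L a = c * support_function K a"
  shows "dilates K L"
proof -
  have "x \<in> L \<longleftrightarrow> (1 / c) *\<^sub>R x \<in> K" for x
    unfolding mem_convex_body0_iff[OF K] mem_convex_body0_iff[OF L]
    using c eq by (auto simp: field_simps)
  note mem = this
  have "L = (\<lambda>y. c *\<^sub>R y) ` K"
  proof (intro set_eqI iffI)
    fix x assume "x \<in> L"
    then show "x \<in> (\<lambda>y. c *\<^sub>R y) ` K"
      using c mem[of x] by (intro image_eqI[of _ _ "(1 / c) *\<^sub>R x"]) auto
  qed (use c mem in auto)
  then show ?thesis using c by (auto simp: dilates_def)
qed

text \<open>The dimension enters where the segment from \<open>a\<close> to \<open>b\<close> contains the origin: there has to be a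
  vector \<open>c\<close> outside the common line of \<open>a\<close> and \<open>b\<close>, through which the two are then linked.\<close>

lemma dilates_if_lower_mean_eq_upper_mean:
  fixes K L :: "'a::euclidean_space set"
  assumes K: "convex_body0 K" and L: "convex_body0 L" and dim: "2 \<le> DIM('a)"
    and eq: "lower_mean (ereal r) K L = upper_mean (ereal r) K L"
  shows "dilates K L"
proof -
  have "\<exists>w. a \<bullet> w = 1 \<and> (\<forall>b. support_function K a * (b \<bullet> w) \<le> support_function K b) \<and>
      (\<forall>b. support_function L a * (b \<bullet> w) \<le> support_function L b)" if a: "a \<noteq> 0" for a
  proof -
    have "norm ((1 / norm a) *\<^sub>R a) = 1" using a by simp
    then obtain v where v: "norm v = 1" "0 < (1 / norm a) *\<^sub>R a \<bullet> v"
        "support_function K ((1 / norm a) *\<^sub>R a) = inverse (gauge_function K v) * ((1 / norm a) *\<^sub>R a \<bullet> v)"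
        "support_function L ((1 / norm a) *\<^sub>R a) = inverse (gauge_function L v) * ((1 / norm a) *\<^sub>R a \<bullet> v)"
      using parallel_contact_points[OF K L eq] by metis
    have v0: "v \<noteq> 0" using v by auto
    have av: "0 < a \<bullet> v" using v(2) a by (simp add: zero_less_divide_iff)
    have supp: "support_function K a = inverse (gauge_function K v) * (a \<bullet> v)"
      "support_function L a = inverse (gauge_function L v) * (a \<bullet> v)"
      using v(3,4) a K L by (auto simp: support_function_scaleR)
    show ?thesis
      by (rule exI[of _ "(1 / (a \<bullet> v)) *\<^sub>R v"])
        (use av supp radial_inner_le_support_function[OF K v0] radial_inner_le_support_function[OF L v0]
          in auto)
  qed
  then obtain w where w: "\<And>a. a \<noteq> 0 \<Longrightarrow> a \<bullet> w a = 1"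
      "\<And>a b. a \<noteq> 0 \<Longrightarrow> support_function K a * (b \<bullet> w a) \<le> support_function K b"
      "\<And>a b. a \<noteq> 0 \<Longrightarrow> support_function L a * (b \<bullet> w a) \<le> support_function L b"
    by metis
  note seg = support_function_ratio_const_on_segment[OF K L w]
  have const: "support_function K a / support_function L a = support_function K b / support_function L b"
    if a: "a \<noteq> 0" and b: "b \<noteq> 0" for a b
  proof (cases "0 \<in> closed_segment a b")
    case True
    have "dim (span {a}) < dim (UNIV :: 'a set)"
      using dim dim_singleton[of a] by (auto split: if_splits)
    then have "span {a} \<noteq> UNIV" by (metis less_irrefl)
    then obtain c where c: "c \<notin> span {a}" by blast
    have "b \<in> span {a}"
    proof -
      obtain u where u: "0 = (1 - u) *\<^sub>R a + u *\<^sub>R b" "0 \<le> u" "u \<le> 1"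
        using True by (auto simp: closed_segment_def)
      then have "u \<noteq> 0" using a by auto
      have "u *\<^sub>R b = - ((1 - u) *\<^sub>R a)" using u by (simp add: eq_neg_iff_add_eq_0 add.commute)
      then have "u *\<^sub>R b \<in> span {a}" by (simp add: span_neg span_scale span_base)
      then show ?thesis using \<open>u \<noteq> 0\<close> span_scale[of "u *\<^sub>R b" "{a}" "1 / u"] by simp
    qed
    have "0 \<notin> closed_segment x c" if x: "x \<noteq> 0" "x \<in> span {a}" for x
    proof
      assume "0 \<in> closed_segment x c"
      then obtain u where u: "0 = (1 - u) *\<^sub>R x + u *\<^sub>R c" by (auto simp: closed_segment_def)
      then have "u \<noteq> 0" using x by auto
      have "u *\<^sub>R c = - ((1 - u) *\<^sub>R x)" using u by (simp add: eq_neg_iff_add_eq_0 add.commute)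
      then have "u *\<^sub>R c \<in> span {a}" using x by (simp add: span_neg span_scale)
      then show False using c \<open>u \<noteq> 0\<close> span_scale[of "u *\<^sub>R c" "{a}" "1 / u"] by simp
    qed
    then have "0 \<notin> closed_segment a c" "0 \<notin> closed_segment b c"
      using a b \<open>b \<in> span {a}\<close> by (auto simp: span_base)
    then show ?thesis using seg[of a c] seg[of b c] by simp
  qed (rule seg)
  obtain e :: 'a where e: "norm e = 1" using vector_choose_size[of 1] by auto
  then have e0: "e \<noteq> 0" by auto
  let ?c = "support_function L e / support_function K e"
  show ?thesis
  proof (rule dilatesI_support_function[OF K L])
    show "?c > 0" using support_function_pos K L e0 by (metis divide_pos_pos)
    fix a :: 'a assume "norm a = 1"
    then have a: "a \<noteq> 0" by auto
    show "support_function L a = ?c * support_function K a"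
      using const[OF a e0] support_function_pos[OF K a] support_function_pos[OF L a]
        support_function_pos[OF K e0] support_function_pos[OF L e0] by (simp add: field_simps)
  qed
qed

theorem theorem1p2:
  fixes K L :: "(real ^ 'n) set" and p :: ereal
  assumes "convex_body0 K" and "convex_body0 L"
  shows "lower_mean p K L \<subseteq> upper_mean p K L \<and>
    (lower_mean p K L = upper_mean p K L \<longleftrightarrow>
       CARD('n) = 1 \<or> p \<in> {-\<infinity>, \<infinity>} \<or> dilates K L)"
proof (intro conjI iffI)
  show sub: "lower_mean p K L \<subseteq> upper_mean p K L"
    using assms by (rule lower_mean_subset_upper_mean)
  show "lower_mean p K L = upper_mean p K L"
    if "CARD('n) = 1 \<or> p \<in> {-\<infinity>, \<infinity>} \<or> dilates K L"
  proof (rule antisym[OF sub])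
    show "upper_mean p K L \<subseteq> lower_mean p K L"
      using that assms upper_mean_subset_lower_mean_dim_1[of K L p]
        upper_mean_subset_lower_mean_minus_infinity[of K L]
        upper_mean_subset_lower_mean_infinity[of K L]
        upper_mean_subset_lower_mean_dilates[of K L p] by auto
  qed
  show "CARD('n) = 1 \<or> p \<in> {-\<infinity>, \<infinity>} \<or> dilates K L"
    if eq: "lower_mean p K L = upper_mean p K L"
  proof (rule ccontr)
    assume *: "\<not> ?thesis"
    then obtain r where r: "p = ereal r" by (cases p) auto
    have "CARD('n) \<noteq> 1" "0 < CARD('n)" using * zero_less_card_finite by auto
    then have "2 \<le> CARD('n)" by linarith
    then have "2 \<le> DIM(real ^ 'n)" by simp
    then show False
      using dilates_if_lower_mean_eq_upper_mean[of K L r] assms eq r * by auto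
  qed
qed

end
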